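(* Let $q$ be a power of an odd prime $p$ and let $m$ be an integer with $m\mid q+1$ and $2\le m\le\frac{q+1}{3}$. If $C'$ is a maximal clique in $\mathrm{GP}(q^2,m)$ which is not a maximum clique, then $|C'|\le\big(\frac{q+1}{m}-1\big)^2$. Moreover, if in addition $p\nmid(m-1)$ and $m\le\frac{q+1}{4}$, then $|C'|\le 1+\frac{q+1}{m}\big(\frac{q+1}{m}-3\big)$.
   Context: The generalised Paley graph $\mathrm{GP}(q^2,m)$ has vertex set $\mathbb{F}_{q^2}$, with two distinct vertices $x,y$ adjacent iff $x-y$ is an $m$-th power of an element of $\mathbb{F}_{q^2}^*$. A clique is maximal if it is not contained in a larger clique, and maximum if no clique of the graph has larger size. *)

theory Defs
  imports "HOL-Library.Ramsey" "HOL-Library.Cardinality" "HOL-Computational_Algebra.Computational_Algebra"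
begin

text \<open>Graphs are given by a vertex set \<open>V\<close> and a set \<open>E\<close> of two-element edges, as for
  \<^const>\<open>clique\<close>. Since \<^const>\<open>clique\<close> only looks at the edges inside the set, containment
  in \<open>V\<close> is stated separately.\<close>

definition maximal_clique :: "'a set \<Rightarrow> 'a set set \<Rightarrow> 'a set \<Rightarrow> bool" where
  "maximal_clique V E C \<longleftrightarrow>
     C \<subseteq> V \<and> clique C E \<and> \<not> (\<exists>D. D \<subseteq> V \<and> clique D E \<and> C \<subset> D)"

text \<open>Meant for finite \<open>V\<close>, where \<^const>\<open>card\<close> is the true size of every subset.\<close>

definition maximum_clique :: "'a set \<Rightarrow> 'a set set \<Rightarrow> 'a set \<Rightarrow> bool" where
  "maximum_clique V E C \<longleftrightarrow>
     C \<subseteq> V \<and> clique C E \<and> \<not> (\<exists>D. D \<subseteq> V \<and> clique D E \<and> card C < card D)"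

text \<open>The generalised Paley graph \<open>GP(q\<^sup>2, m)\<close> has vertex set \<^term>\<open>UNIV\<close> for a field type
  \<open>'a\<close> with \<open>q\<^sup>2\<close> elements. As edges are unordered, the condition below a priori asks that one of
  \<open>x - y\<close> and \<open>y - x\<close> is an \<open>m\<close>-th power; the lemma \<open>gp_edges_iff\<close> shows that it makes no
  difference which of the two is taken.\<close>

definition gp_edges :: "nat \<Rightarrow> 'a::field set set" where
  "gp_edges m = {{x, y} | x y. x \<noteq> y \<and> (\<exists>z. z \<noteq> 0 \<and> x - y = z ^ m)}"

lemma finite_field_power_eq_1:
  fixes a :: "'a::{field,finite}"
  assumes "a \<noteq> 0"
  shows "a ^ (CARD('a) - 1) = 1"
proof -
  let ?S = "UNIV - {0::'a}"
  have "bij_betw ((*) a) ?S ?S"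
    by (rule bij_betwI[where g = "\<lambda>x. x / a"]) (use assms in auto)
  then have "(\<Prod>x\<in>?S. a * x) = \<Prod>?S"
    by (rule prod.reindex_bij_betw)
  then have "a ^ card ?S * \<Prod>?S = 1 * \<Prod>?S"
    by (simp add: prod.distrib)
  moreover have "\<Prod>?S \<noteq> 0"
    by (subst prod_zero_iff) auto
  ultimately have "a ^ card ?S = 1"
    by (subst (asm) mult_right_cancel) auto
  then show ?thesis
    by (simp add: card_Diff_singleton)
qed

lemma minus_one_is_power:
  fixes q m :: nat
  assumes card: "CARD('a::{field,finite}) = q ^ 2" and "odd q" and "m dvd q + 1"
  shows "\<exists>z::'a. z \<noteq> 0 \<and> z ^ m = -1"
proof -
  obtain j where j: "q + 1 = m * j"
    using \<open>m dvd q + 1\<close> by blast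
  obtain i where i: "q = 2 * i + 1"
    using \<open>odd q\<close> by (auto elim: oddE)
  define k where "k = i * j"
  have N: "CARD('a) - 1 = 2 * (m * k)"
  proof -
    have "q ^ 2 - 1 = (q + 1) * (2 * i)"
      by (simp add: i power2_eq_square algebra_simps)
    then show ?thesis
      unfolding card j k_def by (simp add: mult_ac)
  qed
  have "CARD('a) \<ge> 2"
    using card_mono[of UNIV "{0, 1::'a}"] by simp
  then have pos: "m * k > 0"
    using N by linarith
  have "\<exists>g::'a. g \<noteq> 0 \<and> g ^ (m * k) \<noteq> 1"
  proof (rule ccontr)
    assume "\<not> ?thesis"
    then have all: "\<And>g::'a. g \<noteq> 0 \<Longrightarrow> g ^ (m * k) = 1"
      by blast
    let ?p = "monom 1 (m * k) - 1 :: 'a poly"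
    have deg: "degree ?p \<le> m * k"
      by (rule degree_diff_le) (simp_all add: degree_monom_le)
    have "poly ?p 0 \<noteq> 0"
      using pos by (simp add: poly_monom power_0_left)
    then have "?p \<noteq> 0"
      by auto
    have "card (UNIV - {0::'a}) \<le> card {x. poly ?p x = 0}"
      by (rule card_mono) (auto simp: poly_monom all)
    also have "\<dots> \<le> degree ?p"
      using \<open>?p \<noteq> 0\<close> by (rule card_poly_roots_bound)
    finally show False
      using N deg pos by (simp add: card_Diff_singleton)
  qed
  then obtain g :: 'a where g: "g \<noteq> 0" "g ^ (m * k) \<noteq> 1"
    by blast
  have "(g ^ (m * k)) ^ 2 = 1"
    using finite_field_power_eq_1[OF g(1)] N by (simp add: power_mult[symmetric] mult_ac)
  with g(2) have "g ^ (m * k) = -1"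
    unfolding power2_eq_1_iff by blast
  then have "(g ^ k) ^ m = -1"
    by (simp add: power_mult[symmetric] mult.commute)
  then show ?thesis
    using g(1) by (intro exI[of _ "g ^ k"]) simp
qed

lemma gp_edges_iff:
  fixes q m :: nat and x y :: "'a::{field,finite}"
  assumes "CARD('a) = q ^ 2" and "odd q" and "m dvd q + 1"
  shows "{x, y} \<in> gp_edges m \<longleftrightarrow> x \<noteq> y \<and> (\<exists>z. z \<noteq> 0 \<and> x - y = z ^ m)"
proof -
  obtain w :: 'a where w: "w \<noteq> 0" "w ^ m = -1"
    using minus_one_is_power[OF assms] by blast
  have "\<exists>z. z \<noteq> 0 \<and> v - u = z ^ m" if "z \<noteq> 0" "u - v = z ^ m" for u v z :: 'a
    using that w by (intro exI[of _ "w * z"]) (simp add: power_mult_distrib that(2)[symmetric])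
  then show ?thesis
    unfolding gp_edges_def by (auto simp: doubleton_eq_iff)
qed

end

(* The m-th powers form a union S of k = (q+1)/m cosets of F_q^*, so adjacency means that x - y has
   one of k directions in the affine plane over F_q. A point off a line with such a direction has
   at most k - 1 neighbours on it, so a clique not contained in a line meets each line in at most
   k - 1 points; counting along the k lines through a point of the clique gives 1 + k(k-2).
   Maximal cliques contained in a line are whole lines, which have the maximum size q because a
   parallel class in a direction outside S partitions the plane into q cocliques.
   If a clique C has exactly k - 1 points X on a line, X is the neighbourhood on that line of every
   other point of C. When p does not divide k - 1, all these points lie on one line through the
   centroid of X, so C has at most 2k - 3 points; otherwise the count improves to 1 + k(k-3). *)

theory Submission
  imports Defs
begin

section \<open>Fibre counting and powers in finite fields\<close>

lemma card_le_mult_fibres: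
  assumes "finite B" "f ` A \<subseteq> B" "\<And>b. b \<in> B \<Longrightarrow> card {a \<in> A. f a = b} \<le> n"
  shows "card A \<le> n * card B"
proof -
  have "A = (\<Union>b\<in>B. {a \<in> A. f a = b})"
    using assms(2) by auto
  then have "card A \<le> (\<Sum>b\<in>B. card {a \<in> A. f a = b})"
    using card_UN_le[OF assms(1), of "\<lambda>b. {a \<in> A. f a = b}"] by simp
  also have "\<dots> \<le> n * card B"
    using sum_bounded_above[of B, OF assms(3)] by (simp add: mult.commute)
  finally show ?thesis .
qed

lemma card_power_eq_le:
  fixes c :: "'a::field"
  assumes "n > 0"
  shows "card {x. x ^ n = c} \<le> n"
proof -
  let ?p = "monom 1 n - [:c:]"
  have "coeff ?p n = 1"
    using assms by (cases n) (auto simp: coeff_pCons)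
  then have "?p \<noteq> 0"
    by (metis coeff_0 zero_neq_one)
  moreover have "degree ?p \<le> n"
    by (rule degree_diff_le) (simp_all add: degree_monom_le)
  ultimately show ?thesis
    using card_poly_roots_bound[of ?p] by (simp add: poly_monom)
qed

text \<open>The \<open>d\<close>-th powers of units are roots of X^n - 1, which has at most
  \<open>n\<close> roots. The fibres of z -> z^d have at most \<open>d\<close> elements, so there
  are at least \<open>n\<close> such powers. This avoids an appeal to cyclicity of the unit
  group.\<close>

lemma nth_powers_finite_field:
  assumes "CARD('a::{field,finite}) - 1 = d * n"
  shows "{z ^ d | z::'a. z \<noteq> 0} = {x. x ^ n = 1}" and "card {x::'a. x ^ n = 1} = n"
proof -
  let ?P = "{z ^ d | z::'a. z \<noteq> 0}"
  have "CARD('a) \<ge> 2"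
    using card_mono[of UNIV "{0, 1::'a}"] by simp
  then have pos: "d > 0" "n > 0"
    using assms by (auto intro: gr0I)
  have sub: "?P \<subseteq> {x. x ^ n = 1}"
    using finite_field_power_eq_1[where 'a = 'a] unfolding assms by (auto simp: power_mult)
  have "card (UNIV - {0::'a}) \<le> d * card ?P"
  proof (rule card_le_mult_fibres)
    show "card {a \<in> UNIV - {0::'a}. a ^ d = b} \<le> d" for b
      by (rule order_trans[OF card_mono card_power_eq_le[OF pos(1), of b]]) auto
  qed auto
  then have "n \<le> card ?P"
    using assms pos by (simp add: card_Diff_singleton)
  moreover have "card {x::'a. x ^ n = 1} \<le> n"
    using pos(2) by (rule card_power_eq_le)
  moreover have "card ?P \<le> card {x::'a. x ^ n = 1}"
    using sub by (intro card_mono) auto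
  ultimately have "card {x::'a. x ^ n = 1} = n" "card ?P = card {x::'a. x ^ n = 1}"
    by linarith+
  then show "card {x::'a. x ^ n = 1} = n" "?P = {x. x ^ n = 1}"
    using card_subset_eq[OF finite sub] by blast+
qed

section \<open>The affine plane over a subfield, with a set of admissible directions\<close>

text \<open>The axioms make \<open>F\<close> a subfield over which the whole field is a plane, and
  \<open>S\<close> a subgroup of the unit group consisting of \<open>k\<close> cosets of the units
  of \<open>F\<close>. The convention x / 0 = 0 keeps \<open>divide_F\<close> valid for y =
  0.\<close>

locale quadratic_cayley =
  fixes F S :: "'a::{field,finite} set" and k :: nat
  assumes one_F: "1 \<in> F"
    and diff_F: "x \<in> F \<Longrightarrow> y \<in> F \<Longrightarrow> x - y \<in> F"
    and mult_F: "x \<in> F \<Longrightarrow> y \<in> F \<Longrightarrow> x * y \<in> F"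
    and divide_F: "x \<in> F \<Longrightarrow> y \<in> F \<Longrightarrow> x / y \<in> F"
    and CARD_F: "CARD('a) = card F ^ 2"
    and zero_S: "0 \<notin> S"
    and F_S: "F - {0} \<subseteq> S"
    and mult_S: "x \<in> S \<Longrightarrow> y \<in> S \<Longrightarrow> x * y \<in> S"
    and divide_S: "x \<in> S \<Longrightarrow> y \<in> S \<Longrightarrow> x / y \<in> S"
    and card_S: "card S = k * (card F - 1)"
begin

abbreviation cliq :: "'a set \<Rightarrow> bool" where
  "cliq \<equiv> pairwise (\<lambda>x y. x - y \<in> S)"

definition line :: "'a \<Rightarrow> 'a \<Rightarrow> 'a set" where
  "line x s = (\<lambda>t. x + s * t) ` F"

lemma zero_F: "0 \<in> F"
  using diff_F[OF one_F one_F] by simp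

lemma uminus_F: "x \<in> F \<Longrightarrow> - x \<in> F"
  using diff_F[OF zero_F] by simp

lemma add_F: "x \<in> F \<Longrightarrow> y \<in> F \<Longrightarrow> x + y \<in> F"
  using diff_F[OF _ uminus_F] by simp

lemma mult_F_S: "t \<in> F \<Longrightarrow> t \<noteq> 0 \<Longrightarrow> s \<in> S \<Longrightarrow> s * t \<in> S"
  using F_S mult_S by blast

lemma mult_F_S_iff: "t \<in> F \<Longrightarrow> t \<noteq> 0 \<Longrightarrow> s * t \<in> S \<longleftrightarrow> s \<in> S"
  using mult_F_S[of t s] divide_S[of "s * t" t] F_S by auto

lemma card_F_gt_1: "card F > 1"
proof -
  have "card {0, 1::'a} \<le> card F"
    using zero_F one_F by (intro card_mono) auto
  then show ?thesis by simp
qed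

lemma card_F_minus_0: "card (F - {0}) = card F - 1"
  using zero_F by simp

lemma line_cliq: "s \<in> S \<Longrightarrow> cliq (line x s)"
  unfolding line_def pairwise_def
  by (auto simp: mult_F_S diff_F simp flip: right_diff_distrib)

lemma card_line: "s \<noteq> 0 \<Longrightarrow> card (line x s) = card F"
  unfolding line_def by (rule card_image) (auto simp: inj_on_def)

lemma mem_line_iff: "s \<noteq> 0 \<Longrightarrow> z \<in> line x s \<longleftrightarrow> (z - x) / s \<in> F"
  unfolding line_def by (auto simp: image_iff intro!: bexI[where x = "(z - x) / s"])

section \<open>Sizes of cliques and of their intersections with lines\<close>

lemma cliq_card_le:
  assumes "cliq C" and "g \<noteq> 0" and "g \<notin> S"
  shows "card C \<le> card F"
proof -
  \<comment> \<open>The lines in direction \<open>g\<close> through the points of \<open>C\<close>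
    are pairwise disjoint because \<open>g\<close> is outside \<open>S\<close>; hence
    \<open>card C * card F\<close> points fit into a plane of \<open>card F ^ 2\<close>
    points.\<close>
  have "inj_on (\<lambda>(c, t). c + g * t) (C \<times> F)"
  proof (rule inj_onI, clarsimp)
    fix c t c' t' assume *: "c \<in> C" "t \<in> F" "c' \<in> C" "t' \<in> F" "c + g * t = c' + g * t'"
    then have eq: "c - c' = g * (t' - t)"
      by (simp add: algebra_simps)
    have "t = t'"
    proof (rule ccontr)
      assume "t \<noteq> t'"
      then have "g * (t' - t) \<in> S"
        using eq * assms unfolding pairwise_def by (metis eq_iff_diff_eq_0 mult_eq_0_iff)
      then show False
        using \<open>t \<noteq> t'\<close> assms(3) * mult_F_S_iff[of "t' - t" g] diff_F by auto
    qed
    then show "c = c' \<and> t = t'"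
      using eq by simp
  qed
  then have "card (C \<times> F) \<le> CARD('a)"
    by (rule card_inj_on_le) auto
  then show ?thesis
    using card_F_gt_1 by (simp add: card_cartesian_product CARD_F power2_eq_square)
qed

text \<open>For distinct neighbours c in \<open>F\<close>, the differences w - c lie in distinct
  cosets of the units of \<open>F\<close>, and none in the coset \<open>F - {0}\<close> itself,
  because w is outside \<open>F\<close>. This leaves k - 1 of the \<open>k\<close> cosets in
  \<open>S\<close>.\<close>

lemma card_nbrs_F_le:
  assumes "w \<notin> F"
  shows "card {c \<in> F. w - c \<in> S} \<le> k - 1"
proof -
  let ?X = "{c \<in> F. w - c \<in> S}"
  have "inj_on (\<lambda>(c, t). (w - c) * t) (?X \<times> (F - {0}))"
  proof (rule inj_onI)
    fix a a' assume "a \<in> ?X \<times> (F - {0})" "a' \<in> ?X \<times> (F - {0})"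
      and a_eq: "(\<lambda>(c, t). (w - c) * t) a = (\<lambda>(c, t). (w - c) * t) a'"
    then obtain c t c' t' where a: "a = (c, t)" "a' = (c', t')"
      and *: "c \<in> F" "t \<in> F" "t \<noteq> 0" "c' \<in> F" "t' \<in> F" "t' \<noteq> 0"
      by blast
    have eq: "(w - c) * t = (w - c') * t'"
      using a_eq by (simp add: a)
    have "t = t'"
    proof (rule ccontr)
      assume "t \<noteq> t'"
      then have "w = (c * t - c' * t') / (t - t')"
        using eq by (simp add: field_simps)
      then show False
        using assms * by (metis diff_F mult_F divide_F)
    qed
    then show "a = a'"
      using eq * by (simp add: a)
  qed
  moreover have "(\<lambda>(c, t). (w - c) * t) ` (?X \<times> (F - {0})) \<subseteq> S - (F - {0})"
  proof (rule image_subsetI)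
    fix a assume "a \<in> ?X \<times> (F - {0})"
    then obtain c t where a: "a = (c, t)" and *: "c \<in> F" "w - c \<in> S" "t \<in> F" "t \<noteq> 0"
      by blast
    have "w = (w - c) * t / t + c"
      using * by simp
    then have "(w - c) * t \<notin> F"
      using * assms by (metis divide_F add_F)
    then show "(\<lambda>(c, t). (w - c) * t) a \<in> S - (F - {0})"
      using * mult_F_S by (simp add: a)
  qed
  ultimately have "card (?X \<times> (F - {0})) \<le> card (S - (F - {0}))"
    by (rule card_inj_on_le) auto
  also have "\<dots> = (k - 1) * (card F - 1)"
    using F_S by (simp add: card_Diff_subset card_F_minus_0 card_S diff_mult_distrib)
  finally show ?thesis
    using card_F_gt_1 by (simp add: card_cartesian_product card_F_minus_0)
qed

lemma cliq_Int_F_subset: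
  assumes "cliq T" "w \<in> T" "w \<notin> F"
  shows "T \<inter> F \<subseteq> {c \<in> F. w - c \<in> S}"
proof
  fix c assume c: "c \<in> T \<inter> F"
  then have "w \<noteq> c"
    using assms(3) by auto
  then show "c \<in> {c \<in> F. w - c \<in> S}"
    using c pairwiseD[OF assms(1,2)] by simp
qed

text \<open>For nonzero s this affine map carries \<open>line x s\<close> onto \<open>F\<close>. For
  s in \<open>S\<close> it also preserves cliques, so facts about \<open>F\<close> transfer to every
  line with direction in \<open>S\<close>.\<close>

definition normalise :: "'a \<Rightarrow> 'a \<Rightarrow> 'a \<Rightarrow> 'a" where
  "normalise x s z = (z - x) / s"

lemma inj_normalise: "s \<noteq> 0 \<Longrightarrow> inj_on (normalise x s) A"
  unfolding normalise_def inj_on_def by simp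

lemma cliq_normalise:
  assumes "cliq C" "s \<in> S"
  shows "cliq (normalise x s ` C)"
  using assms unfolding pairwise_def normalise_def
  by (auto simp: divide_S simp flip: diff_divide_distrib)

lemma normalise_Int_line:
  assumes "s \<noteq> 0"
  shows "normalise x s ` (C \<inter> line x s) = normalise x s ` C \<inter> F"
  using assms by (auto simp: mem_line_iff normalise_def)

lemma card_normalise_Int:
  assumes "s \<noteq> 0"
  shows "card (normalise x s ` C \<inter> F) = card (C \<inter> line x s)"
  using assms by (metis normalise_Int_line inj_normalise card_image)

lemma normalise_subset_iff: "s \<noteq> 0 \<Longrightarrow> normalise x s ` C \<subseteq> F \<longleftrightarrow> C \<subseteq> line x s"
  by (auto simp: mem_line_iff normalise_def)

lemma card_cliq_Int_line:
  assumes "cliq C" "s \<in> S" "\<not> C \<subseteq> line x s"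
  shows "card (C \<inter> line x s) \<le> k - 1"
proof -
  have s: "s \<noteq> 0"
    using assms(2) zero_S by blast
  define T where "T = normalise x s ` C"
  have "cliq T"
    using assms cliq_normalise by (simp add: T_def)
  obtain w where w: "w \<in> T" "w \<notin> F"
    using assms(3) normalise_subset_iff[OF s] unfolding T_def by blast
  have "T \<inter> F \<subseteq> {c \<in> F. w - c \<in> S}"
    using \<open>cliq T\<close> w by (rule cliq_Int_F_subset)
  then have "card (T \<inter> F) \<le> k - 1"
    using card_nbrs_F_le[OF w(2)] by (meson card_mono finite order_trans)
  then show ?thesis
    using card_normalise_Int[OF s] by (simp add: T_def)
qed

text \<open>Fix x in \<open>C\<close> and sort the pairs (c, t), with c another point of
  \<open>C\<close> and t a unit of \<open>F\<close>, by the value (c - x) * t in \<open>S\<close>.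
  The fibre over s injects into the points of \<open>C\<close> other than x on
  \<open>line x s\<close>, so it has at most \<open>n\<close> elements; then cancel
  \<open>card F - 1\<close>.\<close>

lemma card_cliq_le:
  assumes "cliq C" and "\<And>x s. s \<in> S \<Longrightarrow> card (C \<inter> line x s) \<le> Suc n"
  shows "card C \<le> 1 + k * n"
proof (cases "C = {}")
  case False
  then obtain x where x: "x \<in> C"
    by blast
  let ?A = "(C - {x}) \<times> (F - {0})"
  let ?f = "\<lambda>(c, t). (c - x) * t"
  have "card ?A \<le> n * card S"
  proof (rule card_le_mult_fibres)
    show "?f ` ?A \<subseteq> S"
      using assms(1) x mult_F_S unfolding pairwise_def by auto
    fix s assume s: "s \<in> S"
    then have "s \<noteq> 0"
      using zero_S by blast
    have "inj_on fst {a \<in> ?A. ?f a = s}"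
      by (auto simp: inj_on_def)
    moreover have "fst ` {a \<in> ?A. ?f a = s} \<subseteq> C \<inter> line x s - {x}"
    proof (rule image_subsetI)
      fix a assume "a \<in> {a \<in> ?A. ?f a = s}"
      then obtain c t where a: "a = (c, t)" and *: "c \<in> C" "c \<noteq> x" "t \<in> F" "s = (c - x) * t"
        by auto
      then have "(c - x) / s = 1 / t"
        by simp
      then have "c \<in> line x s"
        using \<open>s \<noteq> 0\<close> \<open>t \<in> F\<close> by (simp add: mem_line_iff divide_F one_F)
      then show "fst a \<in> C \<inter> line x s - {x}"
        using * by (simp add: a)
    qed
    ultimately have "card {a \<in> ?A. ?f a = s} \<le> card (C \<inter> line x s - {x})"
      by (rule card_inj_on_le) auto
    also have "\<dots> \<le> n"
      using assms(2)[OF s, of x] x \<open>s \<noteq> 0\<close> by (simp add: mem_line_iff zero_F)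
    finally show "card {a \<in> ?A. ?f a = s} \<le> n" .
  qed simp
  then have "card (C - {x}) \<le> k * n"
    using card_F_gt_1 by (simp add: card_cartesian_product card_F_minus_0 card_S mult.commute)
  then show ?thesis
    using x by (simp add: card_Diff_singleton)
qed simp

section \<open>Cliques with k - 1 points on a line: the centroid argument\<close>

lemma affine_coords:
  assumes "y \<notin> F"
  shows "\<exists>a\<in>F. \<exists>b\<in>F. z = a * y + b"
proof -
  let ?f = "\<lambda>(a, b). a * y + b"
  \<comment> \<open>Independence of y and 1 over \<open>F\<close> suffices: source and target both
    have \<open>card F ^ 2\<close> elements, so the map is onto.\<close>
  have "inj_on ?f (F \<times> F)"
  proof (rule inj_onI, clarsimp)
    fix a b a' b' assume *: "a \<in> F" "b \<in> F" "a' \<in> F" "b' \<in> F" "a * y + b = a' * y + b'"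
    have "a = a'"
    proof (rule ccontr)
      assume "a \<noteq> a'"
      then have "y = (b' - b) / (a - a')"
        using * by (simp add: field_simps)
      then show False
        using assms * by (metis diff_F divide_F)
    qed
    then show "a = a' \<and> b = b'"
      using * by simp
  qed
  then have "card (?f ` (F \<times> F)) = CARD('a)"
    by (simp add: card_image card_cartesian_product CARD_F power2_eq_square)
  then have "?f ` (F \<times> F) = UNIV"
    by (intro card_subset_eq) auto
  then have "z \<in> ?f ` (F \<times> F)"
    by blast
  then show ?thesis
    by auto
qed

text \<open>The affine map of \<open>F\<close> taking \<open>y\<close> to \<open>z\<close> preserves their common neighbourhood in \<open>F\<close>,
  hence fixes its centroid.\<close>

lemma same_nbrs_collinear:
  assumes "y \<notin> F" "z \<notin> F"
    and y: "X = {c \<in> F. y - c \<in> S}" and z: "X = {c \<in> F. z - c \<in> S}"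
    and nz: "(of_nat (card X) :: 'a) \<noteq> 0"
  shows "\<exists>a\<in>F. z - \<Sum>X / of_nat (card X) = (y - \<Sum>X / of_nat (card X)) * a"
proof -
  let ?n = "of_nat (card X) :: 'a"
  obtain a b where ab: "a \<in> F" "b \<in> F" "z = a * y + b"
    using affine_coords[OF \<open>y \<notin> F\<close>] by blast
  have "a \<noteq> 0"
    using ab \<open>z \<notin> F\<close> by auto
  \<comment> \<open>As z - (a * c + b) = (y - c) * a with a a unit of \<open>F\<close>, neighbours
    of y go to neighbours of z.\<close>
  have sub: "(\<lambda>c. a * c + b) ` X \<subseteq> X"
  proof clarify
    fix c assume "c \<in> X"
    then have "c \<in> F" "(y - c) * a \<in> S"
      using y ab \<open>a \<noteq> 0\<close> mult_F_S by auto
    moreover have "z - (a * c + b) = (y - c) * a"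
      by (simp add: ab algebra_simps)
    ultimately show "a * c + b \<in> X"
      unfolding z using ab add_F mult_F by simp
  qed
  have inj: "inj_on (\<lambda>c. a * c + b) X"
    using \<open>a \<noteq> 0\<close> by (auto simp: inj_on_def)
  then have "(\<lambda>c. a * c + b) ` X = X"
    by (intro card_subset_eq[OF finite sub] card_image)
  then have "\<Sum>X = (\<Sum>c\<in>X. a * c + b)"
    using sum.reindex[OF inj, of "\<lambda>c. c"] by simp
  also have "\<dots> = a * \<Sum>X + ?n * b"
    by (simp add: sum.distrib sum_distrib_left)
  finally have "\<Sum>X / ?n = a * (\<Sum>X / ?n) + b"
    using nz by (simp add: field_simps)
  moreover have "z - (a * \<mu> + b) = (y - \<mu>) * a" for \<mu>
    by (simp add: ab algebra_simps)
  ultimately have "z - \<Sum>X / ?n = (y - \<Sum>X / ?n) * a"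
    by metis
  then show ?thesis
    using ab by blast
qed

lemma centroid_F:
  assumes "X \<subseteq> F"
  shows "\<Sum>X / of_nat (card X) \<in> F"
proof -
  have sum_F: "(\<forall>x\<in>A. f x \<in> F) \<Longrightarrow> sum f A \<in> F" for f :: "'a \<Rightarrow> 'a" and A
    by (induction A rule: infinite_finite_induct) (auto simp: zero_F add_F)
  \<comment> \<open>Writing the cardinality as a sum of ones lets closure under sums cover numerator
    and denominator alike.\<close>
  have "(\<Sum>x\<in>X. x) \<in> F" "(\<Sum>x\<in>X. 1) \<in> F"
    by (rule sum_F; use assms one_F in blast)+
  then have "(\<Sum>x\<in>X. x) / (\<Sum>x\<in>X. 1) \<in> F"
    by (rule divide_F)
  then show ?thesis
    by simp
qed

text \<open>The points of \<open>T\<close> outside \<open>F\<close> lie on one line through the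
  centroid \<mu> of \<open>T \<inter> F\<close>. If there are at least two, its direction is in
  \<open>S\<close> and \<mu> belongs to \<open>T\<close>; so the line holds at most k - 1 points of
  \<open>T\<close>, one of them \<mu>. The total is at most (k - 1) + (k - 2).\<close>

lemma card_cliq_le_if_max_Int_F:
  assumes "cliq T" "\<not> T \<subseteq> F" "card (T \<inter> F) = k - 1"
    and nz: "(of_nat (k - 1) :: 'a) \<noteq> 0" and "k \<ge> 3"
  shows "card T \<le> 2 * k - 3"
proof -
  define X where "X = T \<inter> F"
  define \<mu> where "\<mu> = \<Sum>X / of_nat (card X)"
  have nbrs: "X = {c \<in> F. y - c \<in> S}" if "y \<in> T" "y \<notin> F" for y
  proof (rule card_seteq)
    show "X \<subseteq> {c \<in> F. y - c \<in> S}"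
      unfolding X_def using \<open>cliq T\<close> that by (rule cliq_Int_F_subset)
    show "card {c \<in> F. y - c \<in> S} \<le> card X"
      using card_nbrs_F_le[OF that(2)] assms(3) by (simp add: X_def)
  qed simp
  have split: "card T = card X + card (T - F)"
  proof -
    have "T = X \<union> (T - F)" "X \<inter> (T - F) = {}"
      by (auto simp: X_def)
    then show ?thesis
      by (metis card_Un_disjoint finite)
  qed
  obtain y where y: "y \<in> T" "y \<notin> F"
    using assms(2) by blast
  have "card (T - F) \<le> k - 2"
  proof (cases "T - F = {y}")
    case True
    then show ?thesis using \<open>k \<ge> 3\<close> by simp
  next
    case False
    then obtain z where z: "z \<in> T" "z \<notin> F" "z \<noteq> y"
      using y by blast
    have \<mu>F: "\<mu> \<in> F"
      unfolding \<mu>_def by (rule centroid_F) (auto simp: X_def)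
    have coll: "\<exists>a\<in>F. w - \<mu> = (y - \<mu>) * a" if "w \<in> T" "w \<notin> F" for w
      unfolding \<mu>_def using assms(3) nz y that
      by (intro same_nbrs_collinear nbrs) (simp_all add: X_def)
    obtain a where a: "a \<in> F" "z - \<mu> = (y - \<mu>) * a"
      using coll z by blast
    \<comment> \<open>The difference z - y, which is in \<open>S\<close>, is a multiple of y - \<mu>
      by an element of \<open>F\<close>; this forces y - \<mu> into \<open>S\<close>.\<close>
    have "(y - \<mu>) * (a - 1) = z - \<mu> - (y - \<mu>)"
      unfolding a by (simp add: right_diff_distrib)
    moreover have "z - y \<in> S"
      using \<open>cliq T\<close> y z unfolding pairwise_def by blast
    ultimately have "(y - \<mu>) * (a - 1) \<in> S"
      by simp
    moreover from this have "a - 1 \<noteq> 0"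
      using zero_S by (metis mult_zero_right)
    ultimately have s: "y - \<mu> \<in> S"
      using mult_F_S_iff diff_F a(1) one_F by blast
    then have nz': "y - \<mu> \<noteq> 0"
      using zero_S by metis
    \<comment> \<open>\<mu> is now a neighbour of y on \<open>F\<close>, and \<open>X\<close>
      contains all of these.\<close>
    have "\<mu> \<in> X"
      unfolding nbrs[OF y] using s \<mu>F by simp
    then have \<mu>T: "\<mu> \<in> T"
      by (simp add: X_def)
    have "T - F \<subseteq> line \<mu> (y - \<mu>)"
    proof
      fix w assume "w \<in> T - F"
      then obtain b where "b \<in> F" "w - \<mu> = (y - \<mu>) * b"
        using coll by blast
      then show "w \<in> line \<mu> (y - \<mu>)"
        unfolding mem_line_iff[OF nz'] using nz' by simp
    qed
    then have "T - F \<subseteq> T \<inter> line \<mu> (y - \<mu>) - {\<mu>}"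
      using \<mu>F by blast
    then have "card (T - F) \<le> card (T \<inter> line \<mu> (y - \<mu>) - {\<mu>})"
      by (rule card_mono[rotated]) simp
    also have "\<dots> = card (T \<inter> line \<mu> (y - \<mu>)) - 1"
      using \<mu>T nz' by (simp add: mem_line_iff zero_F)
    also have "\<dots> \<le> k - 1 - 1"
    proof (intro diff_le_mono card_cliq_Int_line)
      \<comment> \<open>Since y is outside \<open>F\<close>, this line meets \<open>F\<close> only
        in \<mu>, whereas \<open>X\<close> has k - 1 >= 2 points.\<close>
      show "\<not> T \<subseteq> line \<mu> (y - \<mu>)"
      proof
        assume *: "T \<subseteq> line \<mu> (y - \<mu>)"
        have "X \<subseteq> {\<mu>}"
        proof
          fix c assume c: "c \<in> X"
          then obtain t where t: "t \<in> F" "c = \<mu> + (y - \<mu>) * t"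
            using * by (auto simp: X_def line_def)
          have "t = 0"
          proof (rule ccontr)
            assume "t \<noteq> 0"
            then have "y = (c - \<mu>) / t + \<mu>"
              using t by simp
            then show False
              using y c t \<mu>F by (metis IntE X_def add_F diff_F divide_F)
          qed
          then show "c \<in> {\<mu>}" using t by simp
        qed
        then have "card X \<le> 1"
          using card_mono[of "{\<mu>}" X] by simp
        then show False
          using assms(3) \<open>k \<ge> 3\<close> by (simp add: X_def)
      qed
    qed (fact assms(1) s)+
    finally show ?thesis by simp
  qed
  then show ?thesis
    using split assms(3) \<open>k \<ge> 3\<close> by (simp add: X_def)
qed

section \<open>Bounds for cliques not contained in a line\<close>

lemma nonlinear_cliq_card_le:
  assumes "cliq C" and "\<And>x s. s \<in> S \<Longrightarrow> \<not> C \<subseteq> line x s" and "k \<ge> 3"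
  shows "card C \<le> (k - 1) ^ 2"
proof -
  have "card C \<le> 1 + k * (k - 2)"
  proof (rule card_cliq_le[OF assms(1)])
    show "card (C \<inter> line x s) \<le> Suc (k - 2)" if "s \<in> S" for x s
      using card_cliq_Int_line[OF assms(1) that assms(2)[OF that], of x] \<open>k \<ge> 3\<close> by simp
  qed
  \<comment> \<open>The substitution removes truncated subtraction; what remains is 1 + (j + 2) * j
    = (j + 1)^2.\<close>
  moreover obtain j where "k = j + 2"
    using \<open>k \<ge> 3\<close> by (intro that[of "k - 2"]) simp
  ultimately show ?thesis
    by (simp add: power2_eq_square)
qed

lemma nonlinear_cliq_card_le':
  assumes "cliq C" and "\<And>x s. s \<in> S \<Longrightarrow> \<not> C \<subseteq> line x s" and "k \<ge> 4"
    and "(of_nat (k - 1) :: 'a) \<noteq> 0"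
  shows "card C \<le> 1 + k * (k - 3)"
proof (cases "\<exists>x. \<exists>s\<in>S. card (C \<inter> line x s) = k - 1")
  case True
  then obtain x s where xs: "s \<in> S" "card (C \<inter> line x s) = k - 1"
    by blast
  then have s: "s \<noteq> 0"
    using zero_S by blast
  have "card (normalise x s ` C) \<le> 2 * k - 3"
    using assms xs s
    by (intro card_cliq_le_if_max_Int_F)
      (auto simp: cliq_normalise card_normalise_Int normalise_subset_iff)
  then have "card C \<le> 2 * k - 3"
    by (simp add: card_image inj_normalise[OF s])
  \<comment> \<open>The target exceeds 2k - 3 by (k - 1)(k - 4), which is nonnegative for k >=
    4.\<close>
  moreover obtain j where "k = j + 4"
    using \<open>k \<ge> 4\<close> by (intro that[of "k - 4"]) simp
  ultimately show ?thesis
    by (simp add: algebra_simps)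
next
  case False
  show ?thesis
  proof (rule card_cliq_le[OF assms(1)])
    fix x s assume s: "s \<in> S"
    then have "card (C \<inter> line x s) \<noteq> k - 1"
      using False by blast
    then show "card (C \<inter> line x s) \<le> Suc (k - 3)"
      using card_cliq_Int_line[OF assms(1) s assms(2)[OF s], of x] \<open>k \<ge> 4\<close> by simp
  qed
qed

end

section \<open>Specialisation to the generalised Paley graph\<close>

lemma of_nat_eq_0_iff_prime_power_field:
  assumes "CARD('a::{field,finite}) = p ^ n" and "prime p"
  shows "(of_nat j :: 'a) = 0 \<longleftrightarrow> p dvd j" and "CHAR('a) = p"
proof -
  have "prime CHAR('a)"
    by (simp add: prime_CHAR_semidom finite_imp_CHAR_pos)
  moreover have "CHAR('a) dvd p ^ n"
  proof -
    \<comment> \<open>Translation by 1 permutes the field, so comparing the sums of all elements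
      shows that the order of the field vanishes in it.\<close>
    have "bij_betw (\<lambda>x::'a. x + 1) UNIV UNIV"
      by (rule bij_betwI[where g = "\<lambda>x. x - 1"]) auto
    then have "(\<Sum>x\<in>UNIV. x + 1) = \<Sum>(UNIV :: 'a set)"
      by (rule sum.reindex_bij_betw)
    then show ?thesis
      using assms(1) by (simp add: sum.distrib flip: of_nat_eq_0_iff_char_dvd of_nat_power)
  qed
  ultimately show "CHAR('a) = p"
    using assms(2) by (metis prime_dvd_power primes_dvd_imp_eq)
  then show "(of_nat j :: 'a) = 0 \<longleftrightarrow> p dvd j"
    by (simp add: of_nat_eq_0_iff_char_dvd)
qed

text \<open>The first set is the fixed field of x -> x^q. As k * (q - 1) = (q^2 - 1) / m, the second
  is the group of nonzero \<open>m\<close>-th powers.\<close>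

lemma quadratic_cayley_paley:
  assumes "prime p" "q = p ^ e" "CARD('a::{field,finite}) = q ^ 2" "q + 1 = m * k"
  shows "quadratic_cayley {x::'a. x ^ q = x} {x. x ^ (k * (q - 1)) = 1} k"
proof -
  have "CARD('a) \<ge> 2"
    using card_mono[of UNIV "{0, 1::'a}"] by simp
  then have q: "q > 1"
    using assms(3) by (cases "q = 0 \<or> q = 1") auto
  have "k > 0"
    using assms(4) by (cases k) auto
  have fac: "CARD('a) - 1 = (q + 1) * (q - 1)"
    unfolding assms(3) by (simp add: power2_eq_square algebra_simps)
  have CHAR: "CHAR('a) = p"
    using assms by (intro of_nat_eq_0_iff_prime_power_field[where n = "e * 2"]) (simp_all add: power_mult)
  have add: "(x + y) ^ q = x ^ q + y ^ q" for x y :: 'a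
    using assms CHAR by (intro freshmans_dream') auto
  have F_eq: "{x::'a. x ^ q = x} = insert 0 {x. x ^ (q - 1) = 1}"
  proof -
    have "x ^ q = x * x ^ (q - 1)" for x :: 'a
      using q by (metis power_eq_if not_less_zero)
    then show ?thesis
      by auto
  qed
  have "card {x::'a. x ^ (q - 1) = 1} = q - 1"
    using fac by (rule nth_powers_finite_field)
  then have card_F: "card {x::'a. x ^ q = x} = q"
    unfolding F_eq using q by (simp add: power_0_left)
  show ?thesis
  proof
    fix x y :: 'a
    assume "x \<in> {x. x ^ q = x}" "y \<in> {x. x ^ q = x}"
    \<comment> \<open>Additivity of the Frobenius map is applied to (x - y) + y, so no sign (-1)^q
      has to be evaluated.\<close>
    then have "(x - y) ^ q + y = x"
      using add[of "x - y" y] by simp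
    then show "x - y \<in> {x. x ^ q = x}"
      by (simp add: eq_diff_eq)
  next
    show "{x. x ^ q = x} - {0} \<subseteq> {x::'a. x ^ (k * (q - 1)) = 1}"
      unfolding F_eq by (auto simp: mult.commute[of k] power_mult)
    show "card {x::'a. x ^ (k * (q - 1)) = 1} = k * (card {x::'a. x ^ q = x} - 1)"
      unfolding card_F using fac[unfolded assms(4) mult.assoc] by (rule nth_powers_finite_field)
    show "CARD('a) = card {x::'a. x ^ q = x} ^ 2"
      using card_F assms(3) by simp
  qed (use q \<open>k > 0\<close> in \<open>auto simp: power_mult_distrib power_divide power_0_left\<close>)
qed

theorem theorem6p1:
  fixes p e q m :: nat and C' :: "'a::{field,finite} set"
  assumes "prime p" and "odd p" and "e \<ge> 1" and "q = p ^ e"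
    and "CARD('a) = q ^ 2"
    and "m dvd q + 1" and "2 \<le> m" and "real m \<le> (real q + 1) / 3"
    and "maximal_clique (UNIV :: 'a set) (gp_edges m) C'"
    and "\<not> maximum_clique (UNIV :: 'a set) (gp_edges m) C'"
  shows "real (card C') \<le> ((real q + 1) / real m - 1) ^ 2 \<and>
    (\<not> p dvd (m - 1) \<and> real m \<le> (real q + 1) / 4 \<longrightarrow>
      real (card C') \<le> 1 + (real q + 1) / real m * ((real q + 1) / real m - 3))"
proof -
  obtain k where k: "q + 1 = m * k"
    using \<open>m dvd q + 1\<close> by blast
  have "odd q"
    using assms(2,4) by simp
  define F where "F = {x::'a. x ^ q = x}"
  define S where "S = {x::'a. x ^ (k * (q - 1)) = 1}"
  interpret quadratic_cayley F S k
    unfolding F_def S_def using assms(1,4,5) k by (rule quadratic_cayley_paley)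
  have rk: "(real q + 1) / real m = real k"
  proof -
    have "real q + 1 = real m * real k"
      using k by (metis of_nat_1 of_nat_add of_nat_mult)
    then show ?thesis
      using \<open>2 \<le> m\<close> by simp
  qed
  \<comment> \<open>Turns the upper bounds on \<open>m\<close> into k >= 3 and k >= 4.\<close>
  have ge: "j \<le> k" if "real m \<le> (real q + 1) / real j" "j > 0" for j
  proof -
    have "real j \<le> (real q + 1) / real m"
      using that \<open>2 \<le> m\<close> by (simp add: field_simps)
    then show ?thesis
      unfolding rk by simp
  qed
  have "k \<ge> 3"
    using ge[of 3] assms(8) by simp
  have fac: "CARD('a) - 1 = m * (k * (q - 1))"
    unfolding assms(5) mult.assoc[symmetric] k[symmetric]
    by (simp add: power2_eq_square algebra_simps)
  have edge: "{x, y} \<in> gp_edges m \<longleftrightarrow> x \<noteq> y \<and> x - y \<in> S" for x y :: 'a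
    using nth_powers_finite_field(1)[OF fac]
    unfolding gp_edges_iff[OF assms(5) \<open>odd q\<close> assms(6)] S_def by auto
  have clique_iff: "clique D (gp_edges m) \<longleftrightarrow> cliq D" for D :: "'a set"
    unfolding clique_def pairwise_def edge by auto
  have "cliq C'" and maximal: "\<And>D. cliq D \<Longrightarrow> C' \<subseteq> D \<Longrightarrow> D = C'"
    using assms(9) unfolding maximal_clique_def clique_iff by auto
  obtain D where D: "cliq D" "card C' < card D"
    using assms(9,10) unfolding maximal_clique_def maximum_clique_def clique_iff by auto
  \<comment> \<open>\<open>S\<close> has index m >= 2 in the unit group, so some direction is
    missing from it.\<close>
  have "\<exists>g. g \<noteq> 0 \<and> g \<notin> S"
  proof (rule ccontr)
    assume "\<not> ?thesis"
    then have "card (UNIV - {0::'a}) \<le> card S"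
      by (intro card_mono) auto
    then have "m * card S \<le> 1 * card S"
      using fac nth_powers_finite_field(2)[OF fac] by (simp add: S_def card_Diff_singleton)
    then show False
      using \<open>2 \<le> m\<close> \<open>k \<ge> 3\<close> card_F_gt_1 by (simp add: card_S)
  qed
  then have "card D \<le> card F"
    using cliq_card_le D(1) by blast
  \<comment> \<open>By maximality, \<open>C'\<close> inside such a line would be the whole line and
    have \<open>card F\<close> points, but the larger clique \<open>D\<close> has at most that
    many.\<close>
  have nonlinear: "\<not> C' \<subseteq> line x s" if "s \<in> S" for x s
    using maximal[OF line_cliq[OF that]] card_line[of s x] that zero_S D \<open>card D \<le> card F\<close>
    by (metis not_le)
  have "real (card C') \<le> real ((k - 1) ^ 2)"
    using nonlinear_cliq_card_le[OF \<open>cliq C'\<close> nonlinear \<open>k \<ge> 3\<close>] by (rule of_nat_mono)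
  then have "real (card C') \<le> (real k - 1) ^ 2"
    using \<open>k \<ge> 3\<close> by (simp add: of_nat_diff)
  moreover have "real (card C') \<le> 1 + real k * (real k - 3)"
    if "\<not> p dvd m - 1" "real m \<le> (real q + 1) / 4"
  proof -
    have "k \<ge> 4"
      using ge[of 4] that by simp
    have of_nat_0_iff: "(of_nat j :: 'a) = 0 \<longleftrightarrow> p dvd j" for j
      using assms(1,4,5)
      by (intro of_nat_eq_0_iff_prime_power_field[where n = "e * 2"]) (simp_all add: power_mult)
    \<comment> \<open>\<open>m k = q + 1 \<equiv> 1\<close> modulo \<open>p\<close>, so \<open>k \<equiv> 1\<close> would force \<open>m \<equiv> 1\<close>.\<close>
    have "(of_nat (k - 1) :: 'a) \<noteq> 0"
    proof
      assume "(of_nat (k - 1) :: 'a) = 0"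
      then have "(of_nat k :: 'a) = 1"
        using \<open>k \<ge> 4\<close> by (simp add: of_nat_diff)
      moreover have "(of_nat q :: 'a) = 0"
        using of_nat_0_iff assms(3,4) by (simp add: dvd_power)
      ultimately have "(of_nat m :: 'a) = 1"
        using arg_cong[OF k, of "of_nat :: nat \<Rightarrow> 'a"] by simp
      then have "(of_nat (m - 1) :: 'a) = 0"
        using \<open>2 \<le> m\<close> by (simp add: of_nat_diff)
      then show False
        using that of_nat_0_iff by blast
    qed
    then have "card C' \<le> 1 + k * (k - 3)"
      using nonlinear_cliq_card_le'[OF \<open>cliq C'\<close> nonlinear \<open>k \<ge> 4\<close>] by blast
    then have "real (card C') \<le> real (1 + k * (k - 3))"
      by (rule of_nat_mono)
    then show ?thesis
      using \<open>k \<ge> 4\<close> by (simp add: of_nat_diff)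
  qed
  ultimately show ?thesis
    unfolding rk by blast
qed

end
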